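(* For every positive integer $n$, the following identity of rational functions in the variables $x_1,\ldots,x_{2n}$ holds: $$S(x_1,\ldots,x_{2n})=(-4)^n\,x_1x_2\cdots x_{2n}\sum_{\bigcup_{k=1}^n\{i_k,j_k\}=\{1,\ldots,2n\}}\ \prod_{k=1}^n\frac{1}{(x_{i_k}-x_{j_k})^2},$$ where the sum runs over all partitions of $\{1,\ldots,2n\}$ into $n$ (unordered) pairs $\{i_1,j_1\},\ldots,\{i_n,j_n\}$.
   Context: Let $S_{2n}$ be the symmetric group of all permutations of $\{1,\ldots,2n\}$, and let $x_1,\ldots,x_{2n}$ be independent variables. The rational function $S(x_1,\ldots,x_{2n})$ is defined as the permanent of the matrix $[x_{j,k}]_{1\le j,k\le 2n}$, where $x_{j,k}=(x_j+x_k)/(x_j-x_k)$ if $j\neq k$ and $x_{j,j}=1$. Equivalently, $$S(x_1,\ldots,x_{2n})=\sum_{\tau\in S_{2n}}\ \prod_{\substack{1\le j\le 2n\\ \tau(j)\neq j}}\frac{x_j+x_{\tau(j)}}{x_j-x_{\tau(j)}},$$ where an empty product equals $1$. (The permanent of $[a_{j,k}]_{1\le j,k\le m}$ is $\sum_{\tau\in S_m}\prod_{j=1}^m a_{j,\tau(j)}$.) *)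

theory Defs
  imports
    "HOL-Library.Poly_Mapping"
    "HOL-Library.Disjoint_Sets"
    "HOL-Combinatorics.Permutations"
    "HOL-Computational_Algebra.Fraction_Field"
begin

text \<open>
  Multivariate polynomials over \<open>'k\<close> are the finitely supported functions from monomials
  \<open>nat \<Rightarrow>\<^sub>0 nat\<close> (exponent vectors) to coefficients, with convolution as multiplication.
  There is one variable for every natural number; since
  $k(x_1,\ldots,x_m)$ is a subfield of $k(x_0,x_1,x_2,\ldots)$, an identity that mentions
  only $x_1,\ldots,x_m$ may be read in either field.
\<close>

type_synonym 'k mpolynomial = "(nat \<Rightarrow>\<^sub>0 nat) \<Rightarrow>\<^sub>0 'k"

type_synonym 'k ratfun = "'k mpolynomial fract"

definition indet :: "nat \<Rightarrow> 'k::field ratfun" where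
  "indet i = Fract (Poly_Mapping.single (Poly_Mapping.single i 1) 1) 1"

definition permanent :: "nat \<Rightarrow> (nat \<Rightarrow> nat \<Rightarrow> 'a::comm_ring_1) \<Rightarrow> 'a" where
  "permanent m A = (\<Sum>\<tau> | \<tau> permutes {1..m}. \<Prod>j\<in>{1..m}. A j (\<tau> j))"

definition S_entry :: "(nat \<Rightarrow> 'a::field) \<Rightarrow> nat \<Rightarrow> nat \<Rightarrow> 'a" where
  "S_entry x j k = (if j = k then 1 else (x j + x k) / (x j - x k))"

definition S_fun :: "nat \<Rightarrow> (nat \<Rightarrow> 'a::field) \<Rightarrow> 'a" where
  "S_fun m x = permanent m (S_entry x)"

definition pair_partitions :: "'a set \<Rightarrow> 'a set set set" where
  "pair_partitions A = {P. partition_on A P \<and> (\<forall>B\<in>P. card B = 2)}"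

text \<open>
  For a two-element set $B = \{i,j\}$ this is $1/(x_i-x_j)^2$. The expression is symmetric in
  $i$ and $j$, so naming the two elements by \<open>Min\<close> and \<open>Max\<close> is an arbitrary choice.
\<close>

definition pair_weight :: "(nat \<Rightarrow> 'a::field) \<Rightarrow> nat set \<Rightarrow> 'a" where
  "pair_weight x B = 1 / (x (Min B) - x (Max B))^2"

end

theory Submission
  imports Defs "HOL-Computational_Algebra.Polynomial"
begin

text \<open>
  Put $u_{jk} = (x_j+x_k)/(x_j-x_k)$ and add an auxiliary variable $s$ to every entry of the matrix,
  so that the entries become $v_{jk} = u_{jk}+s$ and $v_{jj} = 1+s$; let $F_A(s)$ be the permanent of
  the submatrix indexed by $A$. A permutation of $B \cup \{a\}$ either fixes $a$ or arises from a
  permutation $q$ of $B$ by inserting $a$ into an arc $c \to q(c)$. The addition law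
  $v_{ca} v_{ad} = s^2-1 + v_{cd}(u_{ca}-u_{da}) + [c=d]\,w_{ac}$ with
  $w_{ac} = 1-u_{ac}^2 = -4x_ax_c/(x_a-x_c)^2$ makes the middle term telescope along $q$, and thus
  $F_{B\cup\{a\}} = (1+s)F_B + (s^2-1)F_B' + \sum_{b\in B} w_{ab}F_{B\setminus\{b\}}$.
  By induction $F_A = M_A + (1+s)R_A$, where $M_A$ is the sum over perfect matchings with weights $w$
  and $R_A$ contains only powers $s^i$ with $i \equiv |A|-1$ modulo 2. For even $|A|$ this gives
  $F_A(0) = M_A$.
\<close>

section \<open>Permanents and insertion of a point into a permutation\<close>

text \<open>Composing with the transposition cuts the arc from \<open>c\<close> to
  \<open>q c\<close> and reroutes it through \<open>a\<close>, so only the factors at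
  \<open>c\<close> and \<open>a\<close> change. A fixed point \<open>c\<close> becomes the two-cycle
  of \<open>a\<close> and \<open>c\<close>.\<close>

lemma prod_transpose_comp_permutes:
  fixes f :: "'a \<Rightarrow> 'a \<Rightarrow> 'b::comm_monoid_mult"
  assumes "finite B" "a \<notin> B" "q permutes B" "c \<in> B"
  shows "(\<Prod>j\<in>insert a B. f j ((transpose a (q c) \<circ> q) j)) =
    f c a * f a (q c) * (\<Prod>j\<in>B - {c}. f j (q j))"
proof -
  have qa: "q a = a"
    using assms by (simp add: permutes_not_in)
  have inj: "q j = q c \<longleftrightarrow> j = c" for j
    using permutes_inj[OF assms(3)] by (auto dest: injD)
  have qB: "q j \<in> B" if "j \<in> B" for j
    using permutes_in_image[OF assms(3)] that by simp
  have "(\<Prod>j\<in>insert a B. f j ((transpose a (q c) \<circ> q) j)) =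
      f a (q c) * (\<Prod>j\<in>B. f j (transpose a (q c) (q j)))"
    using assms qa by simp
  also have "(\<Prod>j\<in>B. f j (transpose a (q c) (q j))) =
      f c a * (\<Prod>j\<in>B - {c}. f j (transpose a (q c) (q j)))"
    using assms by (subst prod.remove[of B c]) auto
  also have "(\<Prod>j\<in>B - {c}. f j (transpose a (q c) (q j))) = (\<Prod>j\<in>B - {c}. f j (q j))"
    using assms(2) qB inj by (intro prod.cong refl) (auto simp: transpose_def)
  finally show ?thesis
    by (simp add: ac_simps)
qed

text \<open>Each permutation of \<open>insert a B\<close> is uniquely
  \<open>transpose a b \<circ> q\<close>. The case \<open>b = a\<close> fixes \<open>a\<close>; for
  \<open>b\<close> in \<open>B\<close>, reindexing by \<open>b = q c\<close> turns the choice of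
  \<open>b\<close> into the choice of an arc of \<open>q\<close>.\<close>

lemma sum_permutes_insert:
  fixes f :: "'a \<Rightarrow> 'a \<Rightarrow> 'b::comm_semiring_1"
  assumes "finite B" "a \<notin> B"
  shows "(\<Sum>p | p permutes insert a B. \<Prod>j\<in>insert a B. f j (p j)) =
    f a a * (\<Sum>q | q permutes B. \<Prod>j\<in>B. f j (q j)) +
    (\<Sum>q | q permutes B. \<Sum>c\<in>B. f c a * f a (q c) * (\<Prod>j\<in>B - {c}. f j (q j)))"
proof -
  let ?g = "\<lambda>b q. \<Prod>j\<in>insert a B. f j ((transpose a b \<circ> q) j)"
  have "(\<Sum>p | p permutes insert a B. \<Prod>j\<in>insert a B. f j (p j)) =
      (\<Sum>b\<in>insert a B. \<Sum>q | q permutes B. ?g b q)"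
    by (rule sum_over_permutations_insert[OF assms])
  also have "\<dots> = (\<Sum>q | q permutes B. ?g a q) + (\<Sum>b\<in>B. \<Sum>q | q permutes B. ?g b q)"
    using assms by simp
  also have "(\<Sum>b\<in>B. \<Sum>q | q permutes B. ?g b q) = (\<Sum>q | q permutes B. \<Sum>b\<in>B. ?g b q)"
    by (rule sum.swap)
  also have "\<dots> = (\<Sum>q | q permutes B. \<Sum>c\<in>B. ?g (q c) q)"
    by (rule sum.cong[OF refl], rule sum.reindex_bij_betw[symmetric]) (simp add: permutes_imp_bij)
  also have "\<dots> = (\<Sum>q | q permutes B. \<Sum>c\<in>B. f c a * f a (q c) * (\<Prod>j\<in>B - {c}. f j (q j)))"
    using assms by (intro sum.cong refl prod_transpose_comp_permutes) auto
  also have "(\<Sum>q | q permutes B. ?g a q) = (\<Sum>q | q permutes B. f a a * (\<Prod>j\<in>B. f j (q j)))"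
    using assms by (intro sum.cong refl) (simp add: permutes_not_in)
  finally show ?thesis
    by (simp add: sum_distrib_left)
qed

lemma permutes_Diff_singleton_iff:
  "q permutes B - {c} \<longleftrightarrow> q permutes B \<and> q c = c"
proof
  assume q: "q permutes B - {c}"
  then show "q permutes B \<and> q c = c"
    using permutes_subset[OF q, of B] permutes_not_in[OF q, of c] by blast
next
  assume "q permutes B \<and> q c = c"
  then show "q permutes B - {c}"
    by (auto intro: permutes_superset[of q B])
qed

section \<open>The shifted matrix and its addition law\<close>

definition shifted_entry :: "(nat \<Rightarrow> 'a::field) \<Rightarrow> nat \<Rightarrow> nat \<Rightarrow> 'a poly" where
  "shifted_entry x j k = [:S_entry x j k, 1:]"

definition shifted_perm :: "(nat \<Rightarrow> 'a::field) \<Rightarrow> nat set \<Rightarrow> 'a poly" where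
  "shifted_perm x A = (\<Sum>p | p permutes A. \<Prod>j\<in>A. shifted_entry x j (p j))"

text \<open>This is the weight w of a pair; the factor -4 and the variables are distributed over the
  blocks, so that a product over a matching collects the prefactor of the theorem.\<close>

definition matching_weight :: "(nat \<Rightarrow> 'a::field) \<Rightarrow> nat set \<Rightarrow> 'a" where
  "matching_weight x B = - 4 * (\<Prod>i\<in>B. x i) * pair_weight x B"

lemma matching_weight_doubleton:
  assumes "a \<noteq> b"
  shows "matching_weight x {a, b} = - 4 * x a * x b / (x a - x b)\<^sup>2"
  using assms
  by (cases "a < b") (auto simp: matching_weight_def pair_weight_def min_def max_def power2_commute)

lemma S_entry_swap: "j \<noteq> k \<Longrightarrow> S_entry x k j = - S_entry x j k"
  using minus_divide_right[of "x j + x k" "x j - x k"] by (simp add: S_entry_def add.commute)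

text \<open>With \<open>x j\<close> = exp(2 t_j) the entry is coth(t_j - t_k), and this is the
  addition formula of coth for the differences t_c - t_a and t_a - t_d.\<close>

lemma S_entry_mult:
  fixes x :: "nat \<Rightarrow> 'a::field"
  assumes "x c \<noteq> x a" "x d \<noteq> x a" "x c \<noteq> x d"
  shows "S_entry x c a * S_entry x a d = S_entry x c d * (S_entry x c a + S_entry x a d) - 1"
proof -
  have "(p + r) / (p - r) * ((r + q) / (r - q)) =
      (p + q) / (p - q) * ((p + r) / (p - r) + (r + q) / (r - q)) - 1"
    if "p - r \<noteq> 0" "r - q \<noteq> 0" "p - q \<noteq> 0" for p q r :: 'a
    using that by (simp add: divide_simps) (simp add: algebra_simps power2_eq_square)
  from this[of "x c" "x a" "x d"] assms show ?thesis
    by (auto simp: S_entry_def)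
qed

lemma one_minus_S_entry_power2:
  fixes x :: "nat \<Rightarrow> 'a::field"
  assumes "x a \<noteq> x c"
  shows "1 - (S_entry x a c)\<^sup>2 = matching_weight x {a, c}"
proof -
  have "1 - ((p + q) / (p - q))\<^sup>2 = - 4 * p * q / (p - q)\<^sup>2" if "p - q \<noteq> 0" for p q :: 'a
    using that by (simp add: divide_simps) (simp add: algebra_simps power2_eq_square)
  from this[of "x a" "x c"] assms show ?thesis
    by (auto simp: S_entry_def matching_weight_doubleton)
qed

text \<open>The shift s multiplies the same sum of entries that appears in
  \<open>S_entry_mult\<close>, hence the common factor \<open>shifted_entry x c d\<close>.
  Antisymmetry turns that sum into a difference of one function at \<open>c\<close> and
  \<open>d\<close>, ready to telescope for \<open>d = q c\<close>. If \<open>c = d\<close>, the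
  difference vanishes and \<open>one_minus_S_entry_power2\<close> supplies the correction.\<close>

lemma shifted_entry_mult:
  assumes "x c \<noteq> x a" "x d \<noteq> x a" "c \<noteq> d \<Longrightarrow> x c \<noteq> x d"
  shows "shifted_entry x c a * shifted_entry x a d =
    [:-1, 0, 1:] + shifted_entry x c d * ([:S_entry x c a:] - [:S_entry x d a:]) +
    (if c = d then [:matching_weight x {a, c}:] else 0)"
proof (cases "c = d")
  case True
  have "a \<noteq> c" "x a \<noteq> x c"
    using assms by auto
  then show ?thesis
    using True one_minus_S_entry_power2[of x a c, symmetric]
    by (simp add: shifted_entry_def S_entry_swap[of a d] power2_eq_square)
next
  case False
  have "d \<noteq> a"
    using assms by auto
  then show ?thesis
    using False assms S_entry_mult[of x c a d]
    by (simp add: shifted_entry_def S_entry_swap[of a d] mult.commute)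
qed

section \<open>The recursion for the shifted permanent\<close>

text \<open>Every entry has derivative 1 in s, so the product rule just deletes one factor at a
  time. These deleted products are what remains when an arc is cut.\<close>

lemma pderiv_shifted_perm:
  "pderiv (shifted_perm x A) =
    (\<Sum>p | p permutes A. \<Sum>c\<in>A. \<Prod>j\<in>A - {c}. shifted_entry x j (p j))"
  using higher_pderiv_sum[of 1 "\<lambda>p. \<Prod>j\<in>A. shifted_entry x j (p j)" "{p. p permutes A}"]
  by (simp add: shifted_perm_def pderiv_prod shifted_entry_def pderiv_pCons)

lemma shifted_perm_insert:
  assumes "finite B" "a \<notin> B" "inj_on x (insert a B)"
  shows "shifted_perm x (insert a B) =
    [:1, 1:] * shifted_perm x B + [:-1, 0, 1:] * pderiv (shifted_perm x B) +
    (\<Sum>b\<in>B. [:matching_weight x {a, b}:] * shifted_perm x (B - {b}))"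
proof -
  let ?v = "shifted_entry x" and ?w = "\<lambda>b. [:matching_weight x {a, b}:]"
  let ?d = "\<lambda>c. [:S_entry x c a:]"
  let ?r = "\<lambda>q c. \<Prod>j\<in>B - {c}. ?v j (q j)"
  \<comment> \<open>Abstract polynomials keep the simplifier from multiplying out the concrete
    coefficient lists.\<close>
  have expand: "(D + V * Z + (if P then W else 0)) * r = D * r + V * r * Z + (if P then W * r else 0)"
    for D V Z W r :: "'a poly" and P
    by (simp add: algebra_simps)
  have step: "(\<Sum>c\<in>B. ?v c a * ?v a (q c) * ?r q c) =
      [:-1, 0, 1:] * (\<Sum>c\<in>B. ?r q c) + (\<Sum>c\<in>B. if q c = c then ?w c * ?r q c else 0)"
    if q: "q permutes B" for q
  proof -
    have qB: "q c \<in> B" if "c \<in> B" for c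
      using permutes_in_image[OF q] that by simp
    have neq: "x c \<noteq> x a" "c \<noteq> d \<Longrightarrow> x c \<noteq> x d" if "c \<in> B" "d \<in> B" for c d
      using assms that by (auto simp: inj_on_def)
    have "(\<Sum>c\<in>B. ?v c a * ?v a (q c) * ?r q c) =
        (\<Sum>c\<in>B. [:-1, 0, 1:] * ?r q c + (\<Prod>j\<in>B. ?v j (q j)) * (?d c - ?d (q c)) +
          (if q c = c then ?w c * ?r q c else 0))"
    proof (rule sum.cong)
      fix c assume c: "c \<in> B"
      have P: "(\<Prod>j\<in>B. ?v j (q j)) = ?v c (q c) * ?r q c"
        using assms(1) c by (rule prod.remove)
      have "?v c a * ?v a (q c) = [:-1, 0, 1:] + ?v c (q c) * (?d c - ?d (q c)) +
          (if q c = c then ?w c else 0)"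
        using shifted_entry_mult[of x c a "q c"] neq[of c "q c"] neq[of "q c" c] c qB[OF c]
        by auto
      then show "?v c a * ?v a (q c) * ?r q c =
          [:-1, 0, 1:] * ?r q c + (\<Prod>j\<in>B. ?v j (q j)) * (?d c - ?d (q c)) +
          (if q c = c then ?w c * ?r q c else 0)"
        unfolding P by (simp only: expand)
    qed simp
    also have "\<dots> = [:-1, 0, 1:] * (\<Sum>c\<in>B. ?r q c) +
        (\<Prod>j\<in>B. ?v j (q j)) * ((\<Sum>c\<in>B. ?d c) - (\<Sum>c\<in>B. ?d (q c))) +
        (\<Sum>c\<in>B. if q c = c then ?w c * ?r q c else 0)"
      by (simp only: sum.distrib sum_distrib_left[symmetric] sum_subtractf)
    \<comment> \<open>Since \<open>q\<close> permutes \<open>B\<close>, the two sums of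
      \<open>?d\<close> agree and the middle term cancels.\<close>
    also have "(\<Sum>c\<in>B. ?d (q c)) = (\<Sum>c\<in>B. ?d c)"
      using q by (intro sum.reindex_bij_betw permutes_imp_bij)
    finally show ?thesis
      by simp
  qed
  \<comment> \<open>Permutations of \<open>B\<close> fixing \<open>c\<close> are those of
    \<open>B - {c}\<close>, and the factor at \<open>c\<close> is already deleted.\<close>
  have fixed: "(\<Sum>q | q permutes B. if q c = c then ?w c * ?r q c else 0) =
      ?w c * shifted_perm x (B - {c})" for c
  proof -
    have "(\<Sum>q | q permutes B. if q c = c then ?w c * ?r q c else 0) =
        (\<Sum>q\<in>{q. q permutes B} \<inter> {q. q c = c}. ?w c * ?r q c)"
      using assms(1) by (simp add: sum.inter_restrict finite_permutations del: mult_pCons_left)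
    also have "{q. q permutes B} \<inter> {q. q c = c} = {q. q permutes B - {c}}"
      by (auto simp: permutes_Diff_singleton_iff)
    finally show ?thesis
      by (simp add: shifted_perm_def sum_distrib_left)
  qed
  have "(\<Sum>q | q permutes B. \<Sum>c\<in>B. ?v c a * ?v a (q c) * ?r q c) =
      (\<Sum>q | q permutes B. [:-1, 0, 1:] * (\<Sum>c\<in>B. ?r q c) +
        (\<Sum>c\<in>B. if q c = c then ?w c * ?r q c else 0))"
    by (rule sum.cong) (simp_all only: mem_Collect_eq step)
  also have "\<dots> = [:-1, 0, 1:] * pderiv (shifted_perm x B) +
      (\<Sum>q | q permutes B. \<Sum>c\<in>B. if q c = c then ?w c * ?r q c else 0)"
    by (simp only: pderiv_shifted_perm sum.distrib sum_distrib_left)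
  also have "(\<Sum>q | q permutes B. \<Sum>c\<in>B. if q c = c then ?w c * ?r q c else 0) =
      (\<Sum>c\<in>B. ?w c * shifted_perm x (B - {c}))"
    by (subst sum.swap) (simp only: fixed)
  finally show ?thesis
    unfolding shifted_perm_def[of x "insert a B"] sum_permutes_insert[OF assms(1,2)]
    by (simp add: shifted_perm_def[of x B] shifted_entry_def[of x a a] S_entry_def[of x a a]
        del: mult_pCons_left)
qed

section \<open>Weighted sums over perfect matchings\<close>

definition matching_sum :: "('a set \<Rightarrow> 'b::comm_semiring_1) \<Rightarrow> 'a set \<Rightarrow> 'b" where
  "matching_sum w A = (\<Sum>P\<in>pair_partitions A. \<Prod>B\<in>P. w B)"

lemma finite_pair_partitions: "finite A \<Longrightarrow> finite (pair_partitions A)"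
  by (rule finite_subset[of _ "Pow (Pow A)"]) (auto simp: pair_partitions_def partition_on_def)

lemma card_pair_partition:
  assumes "finite A" "P \<in> pair_partitions A"
  shows "card A = 2 * card P"
proof -
  have P: "partition_on A P" "\<forall>B\<in>P. card B = 2"
    using assms(2) by (auto simp: pair_partitions_def)
  have "card A = (\<Sum>B\<in>P. card B)"
    using P by (intro product_partition) (auto intro: card_ge_0_finite)
  then show ?thesis
    using P(2) by simp
qed

lemma matching_sum_empty: "matching_sum w ({} :: 'a set) = 1"
proof -
  have "pair_partitions ({} :: 'a set) = {{}}"
    by (auto simp: pair_partitions_def partition_on_empty)
  then show ?thesis
    by (simp add: matching_sum_def)
qed

text \<open>Needed for the parity bookkeeping, where the matching sum of the smaller set enters the
  remainder as a constant term.\<close>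

lemma matching_sum_odd:
  assumes "finite A" "odd (card A)"
  shows "matching_sum w A = 0"
proof -
  have "pair_partitions A = {}"
    using card_pair_partition[OF assms(1)] assms(2) by fastforce
  then show ?thesis
    by (simp add: matching_sum_def)
qed

text \<open>Matchings are classified by the partner \<open>b\<close> of \<open>a\<close>; deleting
  the block \<open>{a, b}\<close> leaves a matching of \<open>B - {b}\<close>.\<close>

lemma pair_partitions_insert:
  assumes "a \<notin> B"
  shows "pair_partitions (insert a B) =
    (\<lambda>(b, P). insert {a, b} P) ` (SIGMA b:B. pair_partitions (B - {b}))"
proof (intro equalityI subsetI)
  fix Q assume "Q \<in> pair_partitions (insert a B)"
  then have part: "partition_on (insert a B) Q" and card: "\<And>D. D \<in> Q \<Longrightarrow> card D = 2"
    by (auto simp: pair_partitions_def)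
  obtain D where D: "D \<in> Q" "a \<in> D"
    using part by (auto simp: partition_on_def)
  obtain b where b: "D = {a, b}" "a \<noteq> b"
    using card[OF D(1)] D(2) by (auto simp: card_2_iff doubleton_eq_iff)
  have bB: "b \<in> B"
    using part D(1) b by (auto simp: partition_on_def)
  have Q: "Q = insert {a, b} (Q - {{a, b}})"
    using D(1) b(1) by blast
  have "disjnt {a, b} (\<Union>(Q - {{a, b}}))"
    using disjointD[OF partition_onD2[OF part] D(1)] b(1) by (fastforce simp: disjnt_iff)
  then have "partition_on (insert a B - {a, b}) (Q - {{a, b}})"
    using part Q partition_on_insert by metis
  moreover have "insert a B - {a, b} = B - {b}"
    using assms by blast
  ultimately have "Q - {{a, b}} \<in> pair_partitions (B - {b})"
    using card by (simp add: pair_partitions_def)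
  then show "Q \<in> (\<lambda>(b, P). insert {a, b} P) ` (SIGMA b:B. pair_partitions (B - {b}))"
    using Q bB by (intro image_eqI[of _ _ "(b, Q - {{a, b}})"]) auto
next
  fix Q assume "Q \<in> (\<lambda>(b, P). insert {a, b} P) ` (SIGMA b:B. pair_partitions (B - {b}))"
  then obtain b P where Q: "Q = insert {a, b} P" "b \<in> B" and
    P: "partition_on (B - {b}) P" "\<forall>D\<in>P. card D = 2"
    by (auto simp: pair_partitions_def)
  have "insert a B - {a, b} = B - {b}"
    using assms by blast
  moreover have "disjnt {a, b} (\<Union>P)"
    using partition_onD1[OF P(1)] assms by (auto simp: disjnt_iff)
  ultimately have "partition_on (insert a B) Q"
    using P(1) Q by (simp add: partition_on_insert)
  then show "Q \<in> pair_partitions (insert a B)"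
    using P Q assms by (auto simp: pair_partitions_def card_2_iff)
qed

text \<open>This recursion has the form of the last sum in \<open>shifted_perm_insert\<close>, which
  is how matchings enter the permanent.\<close>

lemma matching_sum_insert:
  assumes "finite B" "a \<notin> B"
  shows "matching_sum w (insert a B) = (\<Sum>b\<in>B. w {a, b} * matching_sum w (B - {b}))"
proof -
  have not_mem: "D \<subseteq> B" if "P \<in> pair_partitions (B - {b})" "D \<in> P" for b P D
    using that by (auto simp: pair_partitions_def partition_on_def)
  have inj: "inj_on (\<lambda>(b, P). insert {a, b} P) (SIGMA b:B. pair_partitions (B - {b}))"
  proof (rule inj_onI, clarify)
    fix b P c Q
    assume b: "b \<in> B" "P \<in> pair_partitions (B - {b})" and c: "c \<in> B" "Q \<in> pair_partitions (B - {c})"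
      and eq: "insert {a, b} P = insert {a, c} Q"
    \<comment> \<open>Blocks of \<open>P\<close> and \<open>Q\<close> lie inside \<open>B\<close>,
      so the inserted pair is the only one containing \<open>a\<close>. This determines first the
      partner, then the rest.\<close>
    have nP: "{a, d} \<notin> P" and nQ: "{a, d} \<notin> Q" for d
      using not_mem b(2) c(2) assms(2) by blast+
    have "{a, b} = {a, c}"
      using eq nP nQ by blast
    then have "b = c"
      using assms(2) b(1) c(1) by (auto simp: doubleton_eq_iff)
    moreover have "P = Q"
      using eq nP nQ \<open>b = c\<close> by (metis insert_ident)
    ultimately show "b = c \<and> P = Q" ..
  qed
  have "matching_sum w (insert a B) =
      (\<Sum>(b, P)\<in>(SIGMA b:B. pair_partitions (B - {b})). \<Prod>D\<in>insert {a, b} P. w D)"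
    unfolding matching_sum_def pair_partitions_insert[OF assms(2)]
    by (subst sum.reindex[OF inj]) (simp add: case_prod_unfold)
  also have "\<dots> = (\<Sum>b\<in>B. \<Sum>P\<in>pair_partitions (B - {b}). \<Prod>D\<in>insert {a, b} P. w D)"
    using assms(1) by (subst sum.Sigma) (auto simp: finite_pair_partitions)
  also have "\<dots> = (\<Sum>b\<in>B. \<Sum>P\<in>pair_partitions (B - {b}). w {a, b} * (\<Prod>D\<in>P. w D))"
  proof (intro sum.cong refl prod.insert)
    fix b P assume P: "P \<in> pair_partitions (B - {b})"
    show "finite P"
      using P assms(1) finite_elements[of "B - {b}" P] by (auto simp: pair_partitions_def)
    show "{a, b} \<notin> P"
      using not_mem[OF P] assms(2) by blast
  qed
  finally show ?thesis
    by (simp add: matching_sum_def sum_distrib_left)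
qed

section \<open>Splitting off the matching sum\<close>

text \<open>Modulo 1+s the recursion reduces to that of \<open>matching_sum\<close>, because s^2-1
  is divisible by 1+s. The parity clause is carried along to control the remainder at s = 0. Strong
  induction is used because both \<open>B\<close> and \<open>B - {b}\<close> occur.\<close>

lemma shifted_perm_eq_matching_sum:
  assumes "finite A" "inj_on x A"
  shows "\<exists>R. shifted_perm x A = [:matching_sum (matching_weight x) A:] + [:1, 1:] * R \<and>
    (\<forall>i. even (i + card A) \<longrightarrow> coeff R i = 0)"
  using assms
proof (induction A rule: finite_psubset_induct)
  case (psubset A)
  let ?M = "matching_sum (matching_weight x)"
  show ?case
  proof (cases "A = {}")
    case True
    then show ?thesis
      by (intro exI[of _ 0]) (simp add: shifted_perm_def matching_sum_empty one_pCons)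
  next
    case False
    then obtain a B where A: "A = insert a B" "a \<notin> B"
      by (meson all_not_in_conv mk_disjoint_insert)
    have B: "finite B" "inj_on x B"
      using psubset.hyps psubset.prems A by (auto intro: inj_on_subset)
    obtain R where R: "shifted_perm x B = [:?M B:] + [:1, 1:] * R"
        "\<And>i. even (i + card B) \<Longrightarrow> coeff R i = 0"
      using psubset.IH[of B] B A by auto
    have "\<forall>b\<in>B. \<exists>R. shifted_perm x (B - {b}) = [:?M (B - {b}):] + [:1, 1:] * R \<and>
        (\<forall>i. even (i + card (B - {b})) \<longrightarrow> coeff R i = 0)"
      using A B by (intro ballI psubset.IH) (auto intro: inj_on_subset)
    then obtain Q where Q: "\<And>b. b \<in> B \<Longrightarrow> shifted_perm x (B - {b}) = [:?M (B - {b}):] + [:1, 1:] * Q b"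
        "\<And>b i. b \<in> B \<Longrightarrow> even (i + card (B - {b})) \<Longrightarrow> coeff (Q b) i = 0"
      by metis
    let ?w = "\<lambda>b. matching_weight x {a, b}"
    \<comment> \<open>The quotient after extracting 1+s from the recursion. The term 2s comes from
      (1+s)^2 + (s^2-1) = (1+s) 2s, the instance of \<open>factor\<close> used below.\<close>
    define T where "T = [:?M B:] + [:0, 2:] * R + [:-1, 0, 1:] * pderiv R + (\<Sum>b\<in>B. [:?w b:] * Q b)"
    have factor: "S * (M + S * R) + D * (R + S * R') + (N + S * Q) =
        N + S * (M + E * R + D * R' + Q)"
      if "S * S + D = S * E" for S D E M N Q R R' :: "'a poly"
    proof -
      have "D = S * E - S * S"
        using that by (simp add: eq_diff_eq add.commute)
      show ?thesis
        unfolding \<open>D = S * E - S * S\<close> by (simp add: algebra_simps)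
    qed
    have "shifted_perm x A = [:1, 1:] * ([:?M B:] + [:1, 1:] * R) +
        [:-1, 0, 1:] * pderiv ([:?M B:] + [:1, 1:] * R) +
        (\<Sum>b\<in>B. [:?w b:] * ([:?M (B - {b}):] + [:1, 1:] * Q b))"
      using shifted_perm_insert[of B a x] psubset.prems A B
      by (simp add: R(1) Q(1) del: mult_pCons_left)
    also have "(\<Sum>b\<in>B. [:?w b:] * ([:?M (B - {b}):] + [:1, 1:] * Q b)) =
        (\<Sum>b\<in>B. [:?w b:] * [:?M (B - {b}):]) + [:1, 1:] * (\<Sum>b\<in>B. [:?w b:] * Q b)"
      by (simp only: distrib_left sum.distrib sum_distrib_left mult.left_commute[of "[:1, 1:]"])
    also have "(\<Sum>b\<in>B. [:?w b:] * [:?M (B - {b}):]) = [:?M A:]"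
      unfolding A(1) matching_sum_insert[OF B(1) A(2)]
      by (rule poly_eqI) (simp add: coeff_sum coeff_pCons mult.commute split: nat.split)
    also have "pderiv ([:?M B:] + [:1, 1:] * R) = R + [:1, 1:] * pderiv R"
      unfolding pderiv_add pderiv_mult by (simp add: pderiv_pCons)
    finally have "shifted_perm x A = [:?M A:] + [:1, 1:] * T"
      unfolding T_def by (rule trans) (rule factor, simp)
    moreover have "coeff T i = 0" if i: "even (i + card A)" for i
    proof -
      \<comment> \<open>Each summand of \<open>T\<close> has the right parity: multiplying by 2s or
        differentiating shifts that of \<open>R\<close> by one, s^2-1 preserves it, and
        \<open>B - {b}\<close> has one element fewer than \<open>B\<close>.\<close>
      have odd: "odd (i + card B)"
        using i A B by simp
      have "coeff (\<Sum>b\<in>B. [:?w b:] * Q b) i = 0"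
        unfolding coeff_sum using odd B by (intro sum.neutral) (auto intro!: Q(2))
      moreover have "coeff [:?M B:] i = 0"
        using odd matching_sum_odd[OF B(1)] by (cases i) auto
      moreover have "coeff ([:0, 2:] * R) i = 0"
        using odd R(2)[of "i - 1"] by (cases i) auto
      moreover have "coeff ([:-1, 0, 1:] * pderiv R) i = 0"
        using odd R(2)[of "i - 1"] R(2)[of "Suc i"]
        by (cases i) (auto simp: coeff_pderiv coeff_pCons split: nat.splits)
      ultimately show ?thesis
        by (simp only: T_def coeff_add add_0)
    qed
    ultimately show ?thesis
      by blast
  qed
qed

section \<open>Evaluation at s = 0 and the identity for indeterminates\<close>

lemma S_fun_eq_shifted_perm: "S_fun m x = poly (shifted_perm x {1..m}) 0"
  by (simp add: S_fun_def permanent_def shifted_perm_def shifted_entry_def poly_sum poly_prod)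

text \<open>The \<open>n\<close> blocks contribute -4 each, and since they partition
  \<open>A\<close>, every \<open>x i\<close> occurs exactly once.\<close>

lemma matching_sum_matching_weight:
  assumes "finite A" "card A = 2 * n"
  shows "matching_sum (matching_weight x) A =
    (- 4) ^ n * (\<Prod>i\<in>A. x i) * (\<Sum>P\<in>pair_partitions A. \<Prod>B\<in>P. pair_weight x B)"
proof -
  have "(\<Prod>B\<in>P. matching_weight x B) = (- 4) ^ n * (\<Prod>i\<in>A. x i) * (\<Prod>B\<in>P. pair_weight x B)"
    if P: "P \<in> pair_partitions A" for P
  proof -
    have part: "partition_on A P"
      using P by (simp add: pair_partitions_def)
    have "(\<Prod>B\<in>P. \<Prod>i\<in>B. x i) = (\<Prod>i\<in>A. x i)"
      by (rule prod.partition[OF assms(1) part, symmetric])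
    then show ?thesis
      unfolding matching_weight_def prod.distrib
      using card_pair_partition[OF assms(1) P] assms(2) by simp
  qed
  then show ?thesis
    by (simp add: matching_sum_def sum_distrib_left)
qed

text \<open>The identity is proved at arbitrary distinct elements of a field; the rational function
  identity is the instance at the indeterminates.\<close>

lemma S_fun_eq_pair_partitions:
  assumes "inj_on x {1..2 * n}"
  shows "S_fun (2 * n) x =
    (- 4) ^ n * (\<Prod>i\<in>{1..2 * n}. x i) *
    (\<Sum>P\<in>pair_partitions {1..2 * n}. \<Prod>B\<in>P. pair_weight x B)"
proof -
  obtain R where "shifted_perm x {1..2 * n} =
      [:matching_sum (matching_weight x) {1..2 * n}:] + [:1, 1:] * R"
    "\<And>i. even (i + 2 * n) \<Longrightarrow> coeff R i = 0"
    using shifted_perm_eq_matching_sum[OF _ assms] by auto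
  \<comment> \<open>At s = 0 the remainder contributes \<open>coeff R 0\<close>, which vanishes
    because \<open>2 * n\<close> is even.\<close>
  then have "S_fun (2 * n) x = matching_sum (matching_weight x) {1..2 * n}"
    by (simp add: S_fun_eq_shifted_perm poly_0_coeff_0)
  then show ?thesis
    by (simp add: matching_sum_matching_weight)
qed

lemma inj_indet: "inj (indet :: nat \<Rightarrow> 'k::field ratfun)"
proof (rule injI)
  fix i j assume "(indet i :: 'k ratfun) = indet j"
  then have "Poly_Mapping.single (Poly_Mapping.single i (1::nat)) (1::'k) =
      Poly_Mapping.single (Poly_Mapping.single j 1) 1"
    by (simp add: indet_def eq_fract)
  \<comment> \<open>Comparing supports peels off the polynomial layer here and the monomial layer
    next.\<close>
  then have "Poly_Mapping.single i (1::nat) = Poly_Mapping.single j 1"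
    by (metis keys_single singleton_inject zero_neq_one)
  then show "i = j"
    by (metis keys_single singleton_inject zero_neq_one)
qed

theorem theorem1p1:
  fixes n :: nat
  assumes "n \<ge> 1"
  shows "S_fun (2 * n) (indet :: nat \<Rightarrow> 'k::field_char_0 ratfun) =
    (- 4) ^ n * (\<Prod>i\<in>{1..2 * n}. indet i) *
    (\<Sum>P\<in>pair_partitions {1..2 * n}. \<Prod>B\<in>P. pair_weight indet B)"
  by (rule S_fun_eq_pair_partitions) (rule inj_on_subset[OF inj_indet subset_UNIV])

end
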